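(* Let $p>0$ be a Perron number. Assume that some Galois conjugate $p'$ of $p$ is not real, and that $$\eta := \tan^{-1}\left(\frac{p-\operatorname{Re}(p')}{|\operatorname{Im}(p')|}\right)\leq 1 .$$ Then $$d_{PF}(p)\geq \frac{2\pi}{3\eta},$$ where $d_{PF}(p)$ denotes the Perron-Frobenius degree of $p$.
   Context: A real algebraic integer $p\geq 1$ is called a Perron number if it is strictly greater than the absolute value of each of its other Galois conjugates (over $\mathbb{Q}$). A non-negative integral square matrix $A$ is called aperiodic if some power of $A$ has strictly positive entries. The spectral radius of a non-negative, integral, aperiodic matrix is a Perron number, and conversely (Lind) every Perron number is the spectral radius of some non-negative, integral, aperiodic matrix. The Perron-Frobenius degree $d_{PF}(p)$ of a Perron number $p$ is the smallest $n$ such that there is an $n\times n$ non-negative, integral, aperiodic matrix with spectral radius equal to $p$. Here $\tan^{-1}$ denotes the arctangent. *)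

theory Defs
  imports
    "HOL-Library.Extended_Real"
    "HOL-Computational_Algebra.Polynomial"
    "Jordan_Normal_Form.Spectral_Radius"
begin

definition is_min_poly :: "complex \<Rightarrow> rat poly \<Rightarrow> bool" where
  "is_min_poly x q \<longleftrightarrow> lead_coeff q = 1 \<and> irreducible q \<and> poly (map_poly of_rat q) x = 0"

definition galois_conjugate :: "complex \<Rightarrow> complex \<Rightarrow> bool" where
  "galois_conjugate x y \<longleftrightarrow> (\<exists>q. is_min_poly x q \<and> poly (map_poly of_rat q) y = 0)"

definition perron_number :: "real \<Rightarrow> bool" where
  "perron_number p \<longleftrightarrow> algebraic_int p \<and> 1 \<le> p \<and>
     (\<forall>z. galois_conjugate (complex_of_real p) z \<and> z \<noteq> complex_of_real p \<longrightarrow> cmod z < p)"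

definition nonneg_int_mat :: "int mat \<Rightarrow> bool" where
  "nonneg_int_mat A \<longleftrightarrow> (\<forall>i < dim_row A. \<forall>j < dim_col A. 0 \<le> A $$ (i, j))"

text \<open>The zeroth power is excluded, so that the one by one zero matrix is not aperiodic.\<close>

definition aperiodic_mat :: "int mat \<Rightarrow> bool" where
  "aperiodic_mat A \<longleftrightarrow> square_mat A \<and> nonneg_int_mat A \<and>
     (\<exists>k > 0. \<forall>i < dim_row A. \<forall>j < dim_row A. 0 < (A ^\<^sub>m k) $$ (i, j))"

text \<open>Empty matrices are excluded: they have empty spectrum, for which
  \<^const>\<open>spectral_radius\<close> takes an unspecified value.\<close>

definition pf_dims :: "real \<Rightarrow> nat set" where
  "pf_dims p = {n. 0 < n \<and> (\<exists>A \<in> carrier_mat n n. aperiodic_mat A \<and>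
     spectral_radius (map_mat complex_of_int A) = p)}"

text \<open>The minimum is taken in the extended naturals, so that the definition is total without
  first proving that \<^term>\<open>pf_dims p\<close> is nonempty. For a Perron number it is nonempty by
  Lind's theorem, and then the value is the ordinary minimum (lemma \<open>pf_degree_eq_Least\<close>).\<close>

definition pf_degree :: "real \<Rightarrow> enat" where
  "pf_degree p = (INF n \<in> pf_dims p. enat n)"

lemma pf_degree_eq_Least:
  assumes "pf_dims p \<noteq> {}"
  shows "pf_degree p = enat (LEAST n. n \<in> pf_dims p)"
proof (rule antisym)
  from assms have "(LEAST n. n \<in> pf_dims p) \<in> pf_dims p"
    by (auto intro: LeastI)
  then show "pf_degree p \<le> enat (LEAST n. n \<in> pf_dims p)"
    unfolding pf_degree_def by (rule INF_lower)
  show "enat (LEAST n. n \<in> pf_dims p) \<le> pf_degree p"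
    unfolding pf_degree_def by (rule INF_greatest) (simp add: Least_le)
qed

end

theory Submission
  imports Defs "HOL-Computational_Algebra.Field_as_Ring"
begin

text \<open>
  Let A be an n by n aperiodic matrix with spectral radius p. By Perron--Frobenius theory p is an
  eigenvalue with a positive eigenvector u, so p is a root of the characteristic polynomial of A;
  this has integer coefficients, so p' and its complex conjugate are eigenvalues of A as well. Let
  \<mu> be the one of the two in the upper half plane and v an eigenvector for it.

  The points \<open>z\<^sub>j = v\<^sub>j / u\<^sub>j\<close> are at most n in number, and multiplication by \<open>\<mu> / p\<close> maps
  each of them to a convex combination of all of them, because \<open>A\<^sub>i\<^sub>j u\<^sub>j / (p u\<^sub>i)\<close> is a
  stochastic matrix. Thus their convex hull is a polygon that a contracting rotation maps into
  itself, and the claim is that such a polygon needs many vertices. Pairing v with a positive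
  eigenvector of the transpose shows that the origin is interior to the polygon, so that its
  support function h is positive (lemma \<open>real_mat_nonreal_eigenvalue_turns\<close>).

  Let z be a vertex that is extreme in the direction \<phi>. Moving z towards \<open>(\<mu> / p) z\<close> must not
  increase the component in that direction. With \<open>tan \<eta> = (p - Re \<mu>) / Im \<mu>\<close> this says that \<phi> is
  ahead of the argument of z by at most \<eta>. While \<phi> increases and z remains extreme, h is
  \<open>\<bar>z\<bar> cos \<psi>\<close> with \<psi> increasing and at most \<eta>. Elementary calculus then shows that
  \<open>K = ln h(\<phi>) - \<phi> tan \<eta>\<close> loses at most \<open>2 \<eta> tan \<eta>\<close> during the reign of a single vertex
  (lemma \<open>ln_cos_drop_le\<close>). But h is periodic, so K loses exactly \<open>2 \<pi> tan \<eta>\<close> in a full turn.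
  Hence there are at least \<open>\<pi> / \<eta>\<close> vertices (lemma \<open>card_rotating_maximizers_ge\<close>). This
  gives \<open>n \<ge> \<pi> / \<eta>\<close>, which is more than the asserted \<open>2 \<pi> / (3 \<eta>)\<close>.
\<close>

section \<open>Polygons whose extreme vertices lag behind\<close>

text \<open>The function \<open>ln cos t - t tan \<eta>\<close> has derivative \<open>- tan t - tan \<eta>\<close>, so it rises up to
  \<open>- \<eta>\<close> and falls from there on. Its greatest loss before \<eta> is the one between \<open>- \<eta>\<close> and \<eta>,
  where the two logarithms agree.\<close>

lemma ln_cos_drop_le:
  fixes \<eta> x y :: real
  assumes "0 < \<eta>" "\<eta> < pi / 2" "- (pi / 2) < x" "x \<le> y" "y \<le> \<eta>"
  shows "ln (cos x) - x * tan \<eta> - 2 * \<eta> * tan \<eta> \<le> ln (cos y) - y * tan \<eta>"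
proof -
  define g where "g = (\<lambda>t. ln (cos t) - t * tan \<eta>)"
  have deriv: "(g has_real_derivative (- tan t - tan \<eta>)) (at t)"
    if "- (pi / 2) < t" "t \<le> \<eta>" for t
  proof -
    have "0 < cos t"
      using that assms by (intro cos_gt_zero_pi) auto
    moreover have "tan t = sin t / cos t"
      by (simp add: tan_def)
    ultimately show ?thesis
      unfolding g_def by (auto intro!: derivative_eq_intros)
  qed
  have up: "g s \<le> g t" if "- (pi / 2) < s" "s \<le> t" "t \<le> - \<eta>" for s t
  proof (rule DERIV_nonneg_imp_nondecreasing[OF that(2)])
    fix r assume "s \<le> r" "r \<le> t"
    then have r: "- (pi / 2) < r" "r \<le> - \<eta>" "r \<le> \<eta>"
      using that assms by auto
    have "tan \<eta> \<le> tan (- r)"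
      by (rule tan_mono_le) (use r assms in auto)
    then show "\<exists>y. (g has_real_derivative y) (at r) \<and> 0 \<le> y"
      using deriv[OF r(1,3)] by auto
  qed
  have down: "g t \<le> g s" if "- \<eta> \<le> s" "s \<le> t" "t \<le> \<eta>" for s t
  proof (rule DERIV_nonpos_imp_nonincreasing[OF that(2)])
    fix r assume "s \<le> r" "r \<le> t"
    then have r: "- (pi / 2) < r" "- r \<le> \<eta>" "r \<le> \<eta>"
      using that assms by auto
    have "tan (- r) \<le> tan \<eta>"
      by (rule tan_mono_le) (use r assms in auto)
    then show "\<exists>y. (g has_real_derivative y) (at r) \<and> y \<le> 0"
      using deriv[OF r(1,3)] by auto
  qed
  have width: "g \<eta> + 2 * \<eta> * tan \<eta> = g (- \<eta>)"
    by (simp add: g_def)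
  have "g x - 2 * \<eta> * tan \<eta> \<le> g y"
  proof (cases "y \<le> - \<eta>")
    case True
    then have "g x \<le> g y"
      using up assms by simp
    moreover have "0 \<le> \<eta> * tan \<eta>"
      using assms by (simp add: tan_pos_pi2_le)
    ultimately show ?thesis
      by simp
  next
    case False
    have "g x \<le> g (- \<eta>)"
      using up[of x "- \<eta>"] down[of "- \<eta>" x] assms by linarith
    moreover have "g \<eta> \<le> g y"
      using down[of y \<eta>] False assms by simp
    ultimately show ?thesis
      using width by simp
  qed
  then show ?thesis
    by (simp add: g_def)
qed

text \<open>The support function of the convex hull of Z in the direction of angle \<phi>, with the
  inner product of the plane written as a real part.\<close>

definition support_fun :: "complex set \<Rightarrow> real \<Rightarrow> real" where
  "support_fun Z \<phi> = Max ((\<lambda>z. Re (cis (- \<phi>) * z)) ` Z)"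

lemma continuous_support_fun:
  assumes "finite Z" "Z \<noteq> {}"
  shows "continuous_on S (support_fun Z)"
  using assms
proof (induction rule: finite_ne_induct)
  case (singleton z)
  show ?case
    unfolding support_fun_def by (auto intro!: continuous_intros)
next
  case (insert z Z)
  have "support_fun (insert z Z) = (\<lambda>\<phi>. max (Re (cis (- \<phi>) * z)) (support_fun Z \<phi>))"
    using insert.hyps by (auto simp: support_fun_def fun_eq_iff)
  moreover have "continuous_on S (\<lambda>\<phi>. max (Re (cis (- \<phi>) * z)) (support_fun Z \<phi>))"
    by (intro continuous_on_max insert.IH) (auto intro!: continuous_intros)
  ultimately show ?case
    by metis
qed

lemma support_fun_attained:
  assumes "finite Z" "Z \<noteq> {}"
  obtains z where "z \<in> Z" "support_fun Z \<phi> = Re (cis (- \<phi>) * z)"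
    "\<And>w. w \<in> Z \<Longrightarrow> Re (cis (- \<phi>) * w) \<le> Re (cis (- \<phi>) * z)"
proof -
  have "support_fun Z \<phi> \<in> (\<lambda>z. Re (cis (- \<phi>) * z)) ` Z"
    unfolding support_fun_def using assms by (intro Max_in) auto
  then obtain z where z: "z \<in> Z" "support_fun Z \<phi> = Re (cis (- \<phi>) * z)"
    by auto
  have "Re (cis (- \<phi>) * w) \<le> Re (cis (- \<phi>) * z)" if "w \<in> Z" for w
    unfolding z(2)[symmetric] support_fun_def using assms that by (intro Max_ge) auto
  with z show ?thesis
    using that by blast
qed

text \<open>Choosing the points one after the other by the intermediate value theorem, each to the
  right of the previous one, makes them increasing although K need not be monotone.\<close>

lemma ordered_level_points:
  fixes K :: "real \<Rightarrow> real"
  assumes cont: "continuous_on {a..b} K" and "a \<le> b" and "0 \<le> d"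
    and drop: "K b = K a - real m * d"
  obtains \<phi> where "\<And>i. i \<le> m \<Longrightarrow> a \<le> \<phi> i \<and> \<phi> i \<le> b \<and> K (\<phi> i) = K a - real i * d"
    and "\<And>i j. i \<le> j \<Longrightarrow> j \<le> m \<Longrightarrow> \<phi> i \<le> \<phi> j"
proof -
  have "\<exists>t. s \<le> t \<and> (Suc i \<le> m \<longrightarrow> t \<le> b \<and> K t = K a - real (Suc i) * d)"
    if "i \<le> m \<longrightarrow> a \<le> s \<and> s \<le> b \<and> K s = K a - real i * d" for i s
  proof (cases "Suc i \<le> m")
    case True
    then have s: "a \<le> s" "s \<le> b" "K s = K a - real i * d"
      using that by auto
    have "real (Suc i) * d \<le> real m * d"
      using True \<open>0 \<le> d\<close> by (intro mult_right_mono) auto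
    then have "K b \<le> K a - real (Suc i) * d"
      using drop by linarith
    moreover have "K a - real (Suc i) * d \<le> K s"
      using s \<open>0 \<le> d\<close> by (simp add: algebra_simps)
    moreover have "continuous_on {s..b} K"
      using cont by (rule continuous_on_subset) (use s in auto)
    ultimately show ?thesis
      using IVT2'[of K b "K a - real (Suc i) * d" s] s by blast
  qed auto
  then have "\<exists>\<phi>. \<forall>i. (i \<le> m \<longrightarrow> a \<le> \<phi> i \<and> \<phi> i \<le> b \<and> K (\<phi> i) = K a - real i * d) \<and> \<phi> i \<le> \<phi> (Suc i)"
    by (intro dependent_nat_choice) (use \<open>a \<le> b\<close> in \<open>auto intro: order_trans\<close>, 
       (meson Suc_leD order_trans)+)
  then obtain \<phi> where \<phi>: "\<And>i. i \<le> m \<Longrightarrow> a \<le> \<phi> i \<and> \<phi> i \<le> b \<and> K (\<phi> i) = K a - real i * d"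
    and "\<And>i. \<phi> i \<le> \<phi> (Suc i)"
    by blast
  then have "\<phi> i \<le> \<phi> j" if "i \<le> j" for i j
    using lift_Suc_mono_le[of \<phi>] that by blast
  with \<phi> show ?thesis
    using that by blast
qed

text \<open>A vertex seen at an acute angle from the direction \<phi> has exactly one argument within
  \<open>pi / 2\<close> of \<phi>. Turning N times, starting at the direction \<open>- (pi / 2)\<close>, only the N + 1 translates
  of the principal argument with k = 0, ..., N can occur; they will label the reigns of the
  vertex.\<close>

lemma lift_of_argument:
  fixes z :: complex
  assumes pos: "0 < Re (cis (- \<phi>) * z)" and "- (pi / 2) \<le> \<phi>" "\<phi> \<le> 2 * pi * real N - pi / 2"
  obtains k where "k \<le> N" "\<bar>\<phi> - (Arg z + 2 * pi * real k)\<bar> < pi / 2"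
    "cis (- \<phi>) * z = cmod z * cis (- (\<phi> - (Arg z + 2 * pi * real k)))"
proof -
  define k where "k = round ((\<phi> - Arg z) / (2 * pi))"
  define \<psi> where "\<psi> = \<phi> - (Arg z + 2 * pi * of_int k)"
  have "\<bar>(\<phi> - Arg z) / (2 * pi) - of_int k\<bar> \<le> 1 / 2"
    unfolding k_def using of_int_round_abs_le[of "(\<phi> - Arg z) / (2 * pi)"] by (simp add: abs_minus_commute)
  then have \<psi>_le: "\<bar>\<psi>\<bar> \<le> pi"
    using pi_gt_zero unfolding \<psi>_def by (auto simp: abs_le_iff field_simps)
  have rot: "cis (- \<psi>) = cis (- \<phi>) * cis (Arg z)"
  proof -
    have "cis (- \<psi>) = cis (- \<phi>) * cis (Arg z) * cis (2 * pi * of_int k)"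
      unfolding \<psi>_def cis_mult by (simp add: algebra_simps)
    also have "cis (2 * pi * of_int k) = 1"
      by (rule cis_multiple_2pi) simp
    finally show ?thesis
      by simp
  qed
  have "z \<noteq> 0"
    using pos by auto
  then have z: "z = cmod z * cis (Arg z)"
    using rcis_cmod_Arg[of z] by (simp add: rcis_def)
  have eq: "cis (- \<phi>) * z = cmod z * cis (- \<psi>)"
    by (subst z) (simp add: rot)
  have "0 < cmod z * cos \<psi>"
    using pos unfolding eq by simp
  then have "0 < cos \<psi>"
    by (simp add: zero_less_mult_iff)
  have \<psi>: "\<bar>\<psi>\<bar> < pi / 2"
  proof (rule ccontr)
    assume "\<not> \<bar>\<psi>\<bar> < pi / 2"
    then have "cos \<bar>\<psi>\<bar> \<le> cos (pi / 2)"
      using \<psi>_le by (intro cos_monotone_0_pi_le) auto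
    with \<open>0 < cos \<psi>\<close> show False
      by simp
  qed
  have Arg: "- pi < Arg z" "Arg z \<le> pi"
    using Arg_bounded by auto
  \<comment> \<open>Below the range: the argument exceeds \<open>\<phi> - pi / 2 \<ge> - pi\<close> and \<open>Arg z \<le> pi\<close>, hence k > -1.\<close>
  have "2 * pi * of_int (-1) < 2 * pi * of_int k"
    using \<psi> Arg assms(2) unfolding abs_less_iff \<psi>_def of_int_minus of_int_1 by linarith
  then have "-1 < k"
    by (subst (asm) mult_less_cancel_left_pos) auto
  \<comment> \<open>Above the range: the argument is below \<open>\<phi> + pi / 2 \<le> 2 pi N\<close> and \<open>Arg z > - pi\<close>, hence
    k < N + 1.\<close>
  have "2 * pi * of_int k < 2 * pi * (of_nat N + 1 :: real)"
    using \<psi> Arg assms(3) unfolding abs_less_iff \<psi>_def distrib_left by linarith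
  then have "of_int k < (of_nat N + 1 :: real)"
    by (subst (asm) mult_less_cancel_left_pos) auto
  then have "k < int N + 1"
    by linarith
  with \<open>-1 < k\<close> have k: "nat k \<le> N" "real (nat k) = of_int k"
    by auto
  show ?thesis
    by (rule that[of "nat k"]) (use k \<psi> eq in \<open>auto simp: \<psi>_def\<close>)
qed

text \<open>Suppose that Z has too few points. In N turns K loses \<open>2 pi N tan \<eta>\<close>, and at most
  \<open>card Z * (N + 1)\<close> pairs of a vertex and one of its arguments are available. The extra
  turn's worth of pairs accounts for a vertex whose reign the starting direction cuts in two; it
  is negligible for large N. Splitting the loss into as many equal parts of size d as there are
  pairs gives one more level point than pairs, so two level points have the same pair; but they
  are at least d apart in K, and d exceeds what K can lose under one pair.\<close>

lemma card_rotating_maximizers_ge: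
  fixes Z :: "complex set" and \<eta> :: real
  assumes fin: "finite Z" and \<eta>: "0 < \<eta>" "\<eta> < pi / 2"
    and pos: "\<And>\<phi>. \<exists>z\<in>Z. 0 < Re (cis (- \<phi>) * z)"
    and lag: "\<And>\<phi> z. z \<in> Z \<Longrightarrow> (\<And>w. w \<in> Z \<Longrightarrow> Re (cis (- \<phi>) * w) \<le> Re (cis (- \<phi>) * z)) \<Longrightarrow>
      - Im (cis (- \<phi>) * z) \<le> tan \<eta> * Re (cis (- \<phi>) * z)"
  shows "pi \<le> real (card Z) * \<eta>"
proof (rule ccontr)
  assume less: "\<not> pi \<le> real (card Z) * \<eta>"
  have "Z \<noteq> {}"
    using pos by auto
  have card: "0 < card Z"
    using fin \<open>Z \<noteq> {}\<close> by (simp add: card_gt_0_iff)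
  have tan: "0 < tan \<eta>"
    using \<eta> by (rule tan_gt_zero)
  define h where "h = support_fun Z"
  obtain N :: nat where N: "real (card Z) * \<eta> < real N * (pi - real (card Z) * \<eta>)"
    using reals_Archimedean3[of "pi - real (card Z) * \<eta>"] less by auto
  define m where "m = card Z * (N + 1)"
  define d where "d = 2 * pi * real N * tan \<eta> / real m"
  have "0 < m"
    using card by (simp add: m_def)
  have "2 * \<eta> * real m < 2 * pi * real N"
    using N by (simp add: m_def algebra_simps)
  then have d: "2 * \<eta> * tan \<eta> < d"
    using \<open>0 < m\<close> tan by (simp add: d_def field_simps)
  then have "0 \<le> d"
    using \<eta> tan by (smt (verit) mult_pos_pos)
  have h_pos: "0 < h \<phi>" for \<phi>
  proof -
    obtain z where "z \<in> Z" "0 < Re (cis (- \<phi>) * z)"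
      using pos by blast
    moreover obtain z' where "h \<phi> = Re (cis (- \<phi>) * z')"
      "\<And>w. w \<in> Z \<Longrightarrow> Re (cis (- \<phi>) * w) \<le> Re (cis (- \<phi>) * z')"
      using support_fun_attained[OF fin \<open>Z \<noteq> {}\<close>] h_def by metis
    ultimately show ?thesis
      by fastforce
  qed
  define K where "K = (\<lambda>\<phi>. ln (h \<phi>) - \<phi> * tan \<eta>)"
  define a where "a = - (pi / 2)"
  define b where "b = 2 * pi * real N - pi / 2"
  \<comment> \<open>The directions a and b are N full turns apart, so the support function agrees there.\<close>
  have "cis (- b) = cis (- a)"
  proof -
    have "cis (- a) = cis (- b) * cis (2 * pi * real N)"
      unfolding a_def b_def cis_mult by simp
    also have "cis (2 * pi * real N) = 1"
      by (rule cis_multiple_2pi) simp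
    finally show ?thesis
      by simp
  qed
  then have "h b = h a"
    by (simp add: h_def support_fun_def)
  then have K_drop: "K b = K a - real m * d"
    using \<open>0 < m\<close> by (simp add: K_def a_def b_def d_def algebra_simps)
  have "continuous_on {a..b} h"
    unfolding h_def using fin \<open>Z \<noteq> {}\<close> by (rule continuous_support_fun)
  then have "continuous_on {a..b} K"
    unfolding K_def using h_pos by (intro continuous_intros) (auto simp: less_imp_neq[symmetric])
  moreover have "a \<le> b"
    by (simp add: a_def b_def)
  ultimately obtain \<phi> where \<phi>: "\<And>i. i \<le> m \<Longrightarrow> a \<le> \<phi> i \<and> \<phi> i \<le> b \<and> K (\<phi> i) = K a - real i * d"
    and mono: "\<And>i j. i \<le> j \<Longrightarrow> j \<le> m \<Longrightarrow> \<phi> i \<le> \<phi> j"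
    using ordered_level_points[of a b K d m] \<open>0 \<le> d\<close> K_drop by blast
  \<comment> \<open>Each level point is assigned a vertex that is extreme there, and its argument next to the
    level point. The hypothesis \<open>lag\<close> bounds the tangent of their difference by \<open>tan \<eta>\<close>.\<close>
  have "\<exists>z k. z \<in> Z \<and> k \<le> N \<and> - (pi / 2) < \<phi> i - (Arg z + 2 * pi * real k) \<and>
      \<phi> i - (Arg z + 2 * pi * real k) \<le> \<eta> \<and>
      0 < cmod z \<and> h (\<phi> i) = cmod z * cos (\<phi> i - (Arg z + 2 * pi * real k))"
    if "i \<le> m" for i
  proof -
    obtain z where z: "z \<in> Z" "h (\<phi> i) = Re (cis (- \<phi> i) * z)"
      "\<And>w. w \<in> Z \<Longrightarrow> Re (cis (- \<phi> i) * w) \<le> Re (cis (- \<phi> i) * z)"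
      using support_fun_attained[OF fin \<open>Z \<noteq> {}\<close>] h_def by metis
    have Re_pos: "0 < Re (cis (- \<phi> i) * z)"
      using h_pos[of "\<phi> i"] z(2) by simp
    have "- (pi / 2) \<le> \<phi> i" "\<phi> i \<le> 2 * pi * real N - pi / 2"
      using \<phi>[OF that] by (auto simp: a_def b_def)
    then obtain k where k: "k \<le> N" "\<bar>\<phi> i - (Arg z + 2 * pi * real k)\<bar> < pi / 2"
      "cis (- \<phi> i) * z = cmod z * cis (- (\<phi> i - (Arg z + 2 * pi * real k)))"
      using lift_of_argument[OF Re_pos] by metis
    define \<psi> where "\<psi> = \<phi> i - (Arg z + 2 * pi * real k)"
    have z': "cis (- \<phi> i) * z = cmod z * cis (- \<psi>)"
      using k(3) unfolding \<psi>_def .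
    have \<psi>: "- (pi / 2) < \<psi>" "\<psi> < pi / 2"
      using k(2) unfolding \<psi>_def abs_less_iff by linarith+
    have "0 < cmod z"
      using Re_pos by auto
    have "0 < cos \<psi>"
      using \<psi> by (rule cos_gt_zero_pi)
    have "cmod z * sin \<psi> \<le> tan \<eta> * (cmod z * cos \<psi>)"
      using lag[OF z(1,3)] unfolding z' by simp
    then have "sin \<psi> \<le> tan \<eta> * cos \<psi>"
      using \<open>0 < cmod z\<close> by (simp add: mult.left_commute)
    then have "sin \<psi> / cos \<psi> \<le> tan \<eta>"
      using \<open>0 < cos \<psi>\<close> by (simp add: pos_divide_le_eq)
    then have "tan \<psi> \<le> tan \<eta>"
      by (simp add: tan_def)
    then have "\<psi> \<le> \<eta>"
      using tan_monotone[of \<eta> \<psi>] \<psi> \<eta> by force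
    moreover have "h (\<phi> i) = cmod z * cos \<psi>"
      unfolding z(2) z' by simp
    ultimately show ?thesis
      using z(1) k(1) \<psi>(1) \<open>0 < cmod z\<close> unfolding \<psi>_def by blast
  qed
  then obtain z k where zk: "\<And>i. i \<le> m \<Longrightarrow> z i \<in> Z \<and> k i \<le> N \<and>
      - (pi / 2) < \<phi> i - (Arg (z i) + 2 * pi * real (k i)) \<and>
      \<phi> i - (Arg (z i) + 2 * pi * real (k i)) \<le> \<eta> \<and>
      0 < cmod (z i) \<and> h (\<phi> i) = cmod (z i) * cos (\<phi> i - (Arg (z i) + 2 * pi * real (k i)))"
    by metis
  \<comment> \<open>For a common pair, K changes between the two points as \<open>ln cos \<psi> - \<psi> tan \<eta>\<close> does.\<close>
  have lifts_distinct: "(z i, k i) \<noteq> (z j, k j)" if "i < j" "j \<le> m" for i j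
  proof
    assume same: "(z i, k i) = (z j, k j)"
    define \<theta> where "\<theta> = Arg (z j) + 2 * pi * real (k j)"
    define x where "x = \<phi> i - \<theta>"
    define y where "y = \<phi> j - \<theta>"
    have i: "- (pi / 2) < x" "x \<le> \<eta>" "h (\<phi> i) = cmod (z j) * cos x"
      and j: "- (pi / 2) < y" "y \<le> \<eta>" "h (\<phi> j) = cmod (z j) * cos y" "0 < cmod (z j)"
      using zk[of i] zk[of j] same that by (auto simp: x_def y_def \<theta>_def)
    have "x \<le> y"
      using mono[of i j] that by (simp add: x_def y_def)
    have "0 < cos x" "0 < cos y"
      using i j \<eta> by (auto intro!: cos_gt_zero_pi)
    then have K: "K (\<phi> i) = ln (cmod (z j)) + ln (cos x) - (x + \<theta>) * tan \<eta>"
      "K (\<phi> j) = ln (cmod (z j)) + ln (cos y) - (y + \<theta>) * tan \<eta>"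
      using i(3) j(3,4) by (auto simp: K_def ln_mult x_def y_def)
    have "K (\<phi> i) - 2 * \<eta> * tan \<eta> \<le> K (\<phi> j)"
      using ln_cos_drop_le[OF \<eta> i(1) \<open>x \<le> y\<close> j(2)] unfolding K by (simp add: algebra_simps)
    moreover have "K (\<phi> i) - K (\<phi> j) = (real j - real i) * d"
      using \<phi>[of i] \<phi>[of j] that by (simp add: algebra_simps)
    moreover have "1 * d \<le> (real j - real i) * d"
      using that \<open>0 \<le> d\<close> by (intro mult_right_mono) auto
    ultimately show False
      using d by linarith
  qed
  have "inj_on (\<lambda>i. (z i, k i)) {..m}"
    by (rule linorder_inj_onI) (use lifts_distinct in auto)
  moreover have "(\<lambda>i. (z i, k i)) ` {..m} \<subseteq> Z \<times> {..N}"
    using zk by auto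
  ultimately have "card {..m} \<le> card (Z \<times> {..N})"
    using fin by (intro card_inj_on_le) auto
  then show False
    by (simp add: m_def card_cartesian_product)
qed

section \<open>Positive eigenvectors of primitive matrices\<close>

lemma smult_pow_mat:
  fixes A :: "'a :: comm_semiring_1 mat"
  assumes A: "A \<in> carrier_mat n n"
  shows "(c \<cdot>\<^sub>m A) ^\<^sub>m k = c ^ k \<cdot>\<^sub>m A ^\<^sub>m k"
proof (induction k)
  case 0
  show ?case
    using A by (intro eq_matI) auto
next
  case (Suc k)
  have "A ^\<^sub>m k \<in> carrier_mat n n"
    using A by simp
  then show ?case
    using A by (intro eq_matI) (auto simp: Suc mult.assoc mult.commute)
qed

lemma pow_mat_commutes:
  fixes A :: "'a :: semiring_1 mat"
  assumes A: "A \<in> carrier_mat n n"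
  shows "A * A ^\<^sub>m k = A ^\<^sub>m k * A"
proof (induction k)
  case 0
  show ?case
    using A by simp
next
  case (Suc k)
  have "A * (A ^\<^sub>m k * A) = (A * A ^\<^sub>m k) * A"
    using A by (intro assoc_mult_mat[symmetric]) auto
  then show ?case
    by (simp add: Suc)
qed

lemma transpose_pow_mat:
  fixes A :: "'a :: comm_semiring_1 mat"
  assumes A: "A \<in> carrier_mat n n"
  shows "(transpose_mat A) ^\<^sub>m k = transpose_mat (A ^\<^sub>m k)"
proof (induction k)
  case 0
  show ?case
    using A by simp
next
  case (Suc k)
  have "(A ^\<^sub>m k)\<^sup>T * A\<^sup>T = (A * A ^\<^sub>m k)\<^sup>T"
    using transpose_mult[OF A pow_carrier_mat[OF A]] by simp
  then show ?case
    by (simp add: Suc pow_mat_commutes[OF A])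
qed

text \<open>The scaled matrix \<open>A / s\<close> has spectral radius below 1, so the entries of its powers are
  bounded by the Jordan normal form.\<close>

lemma pow_mat_entries_bounded:
  fixes A :: "real mat"
  assumes A: "A \<in> carrier_mat n n" and "0 < n"
    and s: "spectral_radius (map_mat complex_of_real A) < s" "0 < s"
  obtains c where "\<And>k i j. i < n \<Longrightarrow> j < n \<Longrightarrow> \<bar>(A ^\<^sub>m k) $$ (i, j)\<bar> \<le> c * s ^ k"
proof -
  define C where "C = map_mat complex_of_real A"
  define B where "B = complex_of_real (1 / s) \<cdot>\<^sub>m C"
  have C: "C \<in> carrier_mat n n" and B: "B \<in> carrier_mat n n"
    using A by (auto simp: B_def C_def)
  obtain e v where e: "spectral_radius B = cmod e" and v: "eigenvector B v e"
    using spectral_radius_mem_max(1)[OF B \<open>0 < n\<close>] by (auto simp: spectrum_def eigenvalue_def)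
  have v': "v \<in> carrier_vec n" "v \<noteq> 0\<^sub>v n" "B *\<^sub>v v = e \<cdot>\<^sub>v v"
    using v B by (auto simp: eigenvector_def)
  have "C *\<^sub>v v = (s * e) \<cdot>\<^sub>v v"
  proof (rule eq_vecI)
    fix i assume "i < dim_vec ((s * e) \<cdot>\<^sub>v v)"
    then have i: "i < n"
      using v' by simp
    have "(B *\<^sub>v v) $ i = (e \<cdot>\<^sub>v v) $ i"
      using v' by simp
    then show "(C *\<^sub>v v) $ i = ((s * e) \<cdot>\<^sub>v v) $ i"
      using i v'(1) C s by (simp add: B_def field_simps)
  qed (use C v' in auto)
  then have "eigenvalue C (s * e)"
    using v' C by (auto simp: eigenvalue_def eigenvector_def)
  then have "cmod (s * e) \<le> spectral_radius C"
    using spectral_radius_mem_max(2)[OF C \<open>0 < n\<close>] by (auto simp: spectrum_def)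
  then have "s * cmod e \<le> spectral_radius C"
    using s by (simp add: norm_mult)
  then have "s * cmod e < s"
    using s(1) by (simp only: C_def)
  then have "spectral_radius B < 1"
    using s(2) e by simp
  then obtain c where c: "\<And>k. norm_bound (B ^\<^sub>m k) c"
    using spectral_radius_jnf_norm_bound_less_1_upper_triangular[OF B] by blast
  have "\<bar>(A ^\<^sub>m k) $$ (i, j)\<bar> \<le> c * s ^ k" if ij: "i < n" "j < n" for k i j
  proof -
    have Ck: "C ^\<^sub>m k = map_mat complex_of_real (A ^\<^sub>m k)"
      unfolding C_def by (rule of_real_hom.mat_hom_pow[OF A, symmetric])
    have "cmod ((B ^\<^sub>m k) $$ (i, j)) \<le> c"
      using c[of k] ij B by (auto simp: norm_bound_def)
    then have "\<bar>(A ^\<^sub>m k) $$ (i, j)\<bar> / s ^ k \<le> c"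
      using ij A s unfolding B_def smult_pow_mat[OF C] Ck
      by (simp add: norm_mult norm_divide norm_power power_one_over)
    then show ?thesis
      using s by (simp add: field_simps)
  qed
  then show ?thesis
    using that by blast
qed

lemma mult_mat_vec_mono:
  fixes M :: "real mat"
  assumes M: "M \<in> carrier_mat n n" "\<And>i j. i < n \<Longrightarrow> j < n \<Longrightarrow> 0 \<le> M $$ (i, j)"
    and v: "v \<in> carrier_vec n" and w: "w \<in> carrier_vec n"
    and le: "\<And>i. i < n \<Longrightarrow> v $ i \<le> w $ i" and i: "i < n"
  shows "(M *\<^sub>v v) $ i \<le> (M *\<^sub>v w) $ i"
  using assms by (auto simp: scalar_prod_def intro!: sum_mono mult_left_mono)

lemma pos_mat_mult_vec_pos:
  fixes M :: "real mat"
  assumes M: "M \<in> carrier_mat n n" "\<And>i j. i < n \<Longrightarrow> j < n \<Longrightarrow> 0 < M $$ (i, j)"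
    and v: "v \<in> carrier_vec n" "v \<noteq> 0\<^sub>v n" "\<And>i. i < n \<Longrightarrow> 0 \<le> v $ i" and i: "i < n"
  shows "0 < (M *\<^sub>v v) $ i"
proof -
  obtain j where j: "j < n" "v $ j \<noteq> 0"
    using v(1,2) by (metis carrier_vecD eq_vecI index_zero_vec)
  then have "0 < v $ j"
    using v(3)[of j] by simp
  then have "0 < (\<Sum>j\<in>{0..<n}. M $$ (i, j) * v $ j)"
    using M(2) v(3) i j by (intro sum_pos2[of _ j]) (auto intro!: mult_nonneg_nonneg simp: less_imp_le)
  then show ?thesis
    using M(1) v(1) i by (simp add: scalar_prod_def)
qed

text \<open>From \<open>A w \<ge> q w\<close> it follows that \<open>A\<^sup>k w \<ge> q\<^sup>k w\<close>. If q exceeded the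
  spectral radius, this would outgrow the bound \<open>c s\<^sup>k\<close> on the entries of \<open>A\<^sup>k\<close> for an s
  strictly between the two.\<close>

lemma spectral_radius_ge_subinvariant:
  fixes A :: "real mat"
  assumes A: "A \<in> carrier_mat n n" and "0 < n"
    and nonneg: "\<And>i j. i < n \<Longrightarrow> j < n \<Longrightarrow> 0 \<le> A $$ (i, j)"
    and w: "w \<in> carrier_vec n" "\<And>i. i < n \<Longrightarrow> 0 < w $ i"
    and "0 < q" and sub: "\<And>i. i < n \<Longrightarrow> q * w $ i \<le> (A *\<^sub>v w) $ i"
  shows "q \<le> spectral_radius (map_mat complex_of_real A)"
proof (rule ccontr)
  assume "\<not> ?thesis"
  then obtain s where s: "max 0 (spectral_radius (map_mat complex_of_real A)) < s" "s < q"
    using dense[of "max 0 (spectral_radius (map_mat complex_of_real A))" q] \<open>0 < q\<close> by auto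
  then obtain c where c: "\<And>k i j. i < n \<Longrightarrow> j < n \<Longrightarrow> \<bar>(A ^\<^sub>m k) $$ (i, j)\<bar> \<le> c * s ^ k"
    using pow_mat_entries_bounded[OF A \<open>0 < n\<close>, of s] by auto
  have growth: "q ^ k * w $ i \<le> (A ^\<^sub>m k *\<^sub>v w) $ i" if "i < n" for k i
    using that
  proof (induction k arbitrary: i)
    case 0
    then show ?case
      using A w by simp
  next
    case (Suc k)
    have "q ^ Suc k * w $ i = q ^ k * (q * w $ i)"
      by simp
    also have "\<dots> \<le> q ^ k * (A *\<^sub>v w) $ i"
      using sub[OF Suc.prems] \<open>0 < q\<close> by (intro mult_left_mono) auto
    also have "\<dots> = (A *\<^sub>v (q ^ k \<cdot>\<^sub>v w)) $ i"
      using A w Suc.prems by simp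
    also have "\<dots> \<le> (A *\<^sub>v (A ^\<^sub>m k *\<^sub>v w)) $ i"
      using A w nonneg Suc mult_mat_vec_carrier[OF pow_carrier_mat[OF A] w(1)]
      by (intro mult_mat_vec_mono[where n = n]) auto
    also have "A *\<^sub>v (A ^\<^sub>m k *\<^sub>v w) = A ^\<^sub>m Suc k *\<^sub>v w"
      using assoc_mult_mat_vec[OF A pow_carrier_mat[OF A] w(1)]
      by (simp add: pow_mat_commutes[OF A])
    finally show ?case .
  qed
  define W where "W = (\<Sum>j\<in>{0..<n}. w $ j)"
  have "(q / s) ^ k \<le> c * W / w $ 0" for k
  proof -
    have "q ^ k * w $ 0 \<le> (\<Sum>j\<in>{0..<n}. (A ^\<^sub>m k) $$ (0, j) * w $ j)"
      using growth[OF \<open>0 < n\<close>, of k] A w \<open>0 < n\<close> by (simp add: scalar_prod_def)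
    also have "\<dots> \<le> (\<Sum>j\<in>{0..<n}. c * s ^ k * w $ j)"
      using c[OF \<open>0 < n\<close>] w by (intro sum_mono mult_right_mono) (auto simp: abs_le_iff less_imp_le)
    also have "\<dots> = c * W * s ^ k"
      by (simp add: W_def sum_distrib_left sum_distrib_right mult_ac)
    finally show ?thesis
      using s w(2)[OF \<open>0 < n\<close>] by (simp add: field_simps power_divide)
  qed
  moreover obtain k where "c * W / w $ 0 < (q / s) ^ k"
    using real_arch_pow[of "q / s" "c * W / w $ 0"] s by auto
  ultimately show False
    by (meson not_le)
qed

text \<open>Wielandt's argument. Let v be an eigenvector for an eigenvalue of modulus p, and y the
  vector of the moduli of its entries. The triangle inequality gives \<open>A y \<ge> p y\<close>. If this were not
  an equality, then applying the positive matrix \<open>A\<^sup>k\<close> would make it strict in every entry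
  for \<open>w = A\<^sup>k y\<close>, and so \<open>A w \<ge> q w\<close> for some q > p, against the previous lemma. Hence
  y is an eigenvector for p, and \<open>p\<^sup>k y = A\<^sup>k y\<close> is positive.\<close>

lemma primitive_positive_eigenvector:
  fixes A :: "real mat"
  assumes A: "A \<in> carrier_mat n n" and "0 < n"
    and nonneg: "\<And>i j. i < n \<Longrightarrow> j < n \<Longrightarrow> 0 \<le> A $$ (i, j)"
    and prim: "\<And>i j. i < n \<Longrightarrow> j < n \<Longrightarrow> 0 < (A ^\<^sub>m k) $$ (i, j)"
    and p: "spectral_radius (map_mat complex_of_real A) = p" "0 < p"
  obtains u where "u \<in> carrier_vec n" "\<And>i. i < n \<Longrightarrow> 0 < u $ i" "A *\<^sub>v u = p \<cdot>\<^sub>v u"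
proof -
  define C where "C = map_mat complex_of_real A"
  have C: "C \<in> carrier_mat n n" and Ak: "A ^\<^sub>m k \<in> carrier_mat n n"
    using A by (auto simp: C_def)
  obtain e v where e: "p = cmod e" and ev: "eigenvector C v e"
    using spectral_radius_mem_max(1)[OF C \<open>0 < n\<close>] p(1)
    by (auto simp: spectrum_def eigenvalue_def C_def)
  have v: "v \<in> carrier_vec n" "v \<noteq> 0\<^sub>v n" "C *\<^sub>v v = e \<cdot>\<^sub>v v"
    using ev C by (auto simp: eigenvector_def)
  define y where "y = vec n (\<lambda>i. cmod (v $ i))"
  define d where "d = A *\<^sub>v y - p \<cdot>\<^sub>v y"
  have y: "y \<in> carrier_vec n" and y_nonneg: "\<And>i. i < n \<Longrightarrow> 0 \<le> y $ i"
    by (auto simp: y_def)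
  have d: "d \<in> carrier_vec n"
    using A y by (auto simp: d_def)
  have y_nz: "y \<noteq> 0\<^sub>v n"
  proof
    assume "y = 0\<^sub>v n"
    then have "v $ i = 0" if "i < n" for i
      using that by (metis index_vec index_zero_vec(1) norm_eq_zero y_def)
    then show False
      using v(1,2) by (auto intro: eq_vecI)
  qed
  have d_nonneg: "0 \<le> d $ i" if i: "i < n" for i
  proof -
    have "p * y $ i = cmod ((C *\<^sub>v v) $ i)"
      using i v e by (simp add: y_def norm_mult)
    also have "\<dots> = cmod (\<Sum>j\<in>{0..<n}. complex_of_real (A $$ (i, j)) * v $ j)"
      using i A v(1) by (simp add: C_def scalar_prod_def)
    also have "\<dots> \<le> (\<Sum>j\<in>{0..<n}. A $$ (i, j) * y $ j)"
      using i nonneg by (intro sum_norm_le) (simp add: norm_mult y_def)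
    also have "\<dots> = (A *\<^sub>v y) $ i"
      using i A y by (simp add: scalar_prod_def)
    finally show ?thesis
      using i A y by (simp add: d_def)
  qed
  have "d = 0\<^sub>v n"
  proof (rule ccontr)
    assume "d \<noteq> 0\<^sub>v n"
    define w where "w = A ^\<^sub>m k *\<^sub>v y"
    have w: "w \<in> carrier_vec n"
      unfolding w_def by (rule mult_mat_vec_carrier[OF Ak y])
    have w_pos: "0 < w $ i" if "i < n" for i
      unfolding w_def using Ak prim y y_nz y_nonneg that by (rule pos_mat_mult_vec_pos)
    have "A ^\<^sub>m k *\<^sub>v d = A ^\<^sub>m k *\<^sub>v (A *\<^sub>v y) - A ^\<^sub>m k *\<^sub>v (p \<cdot>\<^sub>v y)"
      unfolding d_def by (rule mult_minus_distrib_mat_vec[OF Ak]) (use A y in auto)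
    also have "A ^\<^sub>m k *\<^sub>v (A *\<^sub>v y) = (A * A ^\<^sub>m k) *\<^sub>v y"
      using assoc_mult_mat_vec[OF Ak A y] by (simp add: pow_mat_commutes[OF A])
    also have "\<dots> = A *\<^sub>v w"
      unfolding w_def by (rule assoc_mult_mat_vec[OF A Ak y])
    also have "A ^\<^sub>m k *\<^sub>v (p \<cdot>\<^sub>v y) = p \<cdot>\<^sub>v w"
      unfolding w_def by (rule mult_mat_vec[OF Ak y])
    finally have Akd: "A ^\<^sub>m k *\<^sub>v d = A *\<^sub>v w - p \<cdot>\<^sub>v w" .
    have strict: "p * w $ i < (A *\<^sub>v w) $ i" if i: "i < n" for i
    proof -
      have "0 < (A ^\<^sub>m k *\<^sub>v d) $ i"
        using Ak prim d \<open>d \<noteq> 0\<^sub>v n\<close> d_nonneg i by (rule pos_mat_mult_vec_pos)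
      then show ?thesis
        using i w A unfolding Akd by simp
    qed
    define q where "q = Min ((\<lambda>i. (A *\<^sub>v w) $ i / w $ i) ` {..<n})"
    have ne: "{..<n} \<noteq> {}"
      using \<open>0 < n\<close> by auto
    have "p < q"
      unfolding q_def using ne strict w_pos by (simp add: field_simps)
    have "q * w $ i \<le> (A *\<^sub>v w) $ i" if i: "i < n" for i
    proof -
      have "q \<le> (A *\<^sub>v w) $ i / w $ i"
        unfolding q_def using i by (intro Min_le) auto
      then show ?thesis
        using w_pos[OF i] by (simp add: field_simps)
    qed
    then have "q \<le> spectral_radius (map_mat complex_of_real A)"
      using \<open>p < q\<close> p(2) by (intro spectral_radius_ge_subinvariant[OF A \<open>0 < n\<close> nonneg w w_pos]) auto
    then show False
      using \<open>p < q\<close> p(1) by simp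
  qed
  have Ay: "A *\<^sub>v y = p \<cdot>\<^sub>v y"
  proof (rule eq_vecI)
    fix i assume "i < dim_vec (p \<cdot>\<^sub>v y)"
    then have i: "i < n"
      using y by simp
    have "d $ i = 0"
      using \<open>d = 0\<^sub>v n\<close> i by simp
    then show "(A *\<^sub>v y) $ i = (p \<cdot>\<^sub>v y) $ i"
      using i A y by (simp add: d_def)
  qed (use A y in auto)
  then have "eigenvector A y p"
    using A y y_nz by (auto simp: eigenvector_def)
  then have Aky: "A ^\<^sub>m k *\<^sub>v y = p ^ k \<cdot>\<^sub>v y"
    by (rule eigenvector_pow[OF A])
  have "0 < y $ i" if i: "i < n" for i
  proof -
    have "0 < (A ^\<^sub>m k *\<^sub>v y) $ i"
      using Ak prim y y_nz y_nonneg i by (rule pos_mat_mult_vec_pos)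
    then show ?thesis
      using i y p(2) unfolding Aky by (simp add: zero_less_mult_iff)
  qed
  with y Ay show ?thesis
    using that by blast
qed

lemma spectral_radius_transpose:
  assumes "A \<in> carrier_mat n n"
  shows "spectral_radius (transpose_mat A) = spectral_radius A"
  using spectrum_root_char_poly[OF assms] spectrum_root_char_poly[of "transpose_mat A" n] assms
  by (simp add: spectral_radius_def)

section \<open>From matrices to polygons\<close>

text \<open>An irreducible rational polynomial q that shares the root x with f divides f, since otherwise
  a Bezout identity for q and f would give 1 = 0 at x.\<close>

lemma galois_conjugate_root:
  fixes f :: "int poly"
  assumes conj: "galois_conjugate x y" and root: "poly (map_poly of_int f) x = 0"
  shows "poly (map_poly of_int f) y = 0"
proof -
  obtain q where q: "irreducible q" "poly (map_poly of_rat q) x = 0" "poly (map_poly of_rat q) y = 0"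
    using conj by (auto simp: galois_conjugate_def is_min_poly_def)
  interpret map_of_rat: map_poly_comm_ring_hom "of_rat :: rat \<Rightarrow> complex" ..
  define F where "F = map_poly rat_of_int f"
  have F: "map_poly of_rat F = (map_poly of_int f :: complex poly)"
    unfolding F_def by (subst map_poly_map_poly) (auto simp: o_def)
  have "q dvd F"
  proof (rule ccontr)
    assume "\<not> q dvd F"
    then have "coprime q F"
      using q(1) by (intro prime_elem_imp_coprime irreducible_imp_prime_elem_gcd)
    then obtain r s where "r * q + s * F = 1"
      using bezout_coefficients_fst_snd[of q F] by (metis coprime_imp_gcd_eq_1)
    then have "poly (map_poly of_rat (r * q + s * F)) x = 1"
      by simp
    then show False
      using root q(2) by (simp add: hom_distribs F)
  qed
  then obtain r where "F = q * r"
    by (elim dvdE)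
  then have "poly (map_poly of_rat F) y = 0"
    using q(3) by (simp add: hom_distribs)
  then show ?thesis
    by (simp add: F)
qed

text \<open>The two properties of the points \<open>v\<^sub>j / u\<^sub>j\<close> that \<open>card_rotating_maximizers_ge\<close> asks for.

  Pairing v with the positive eigenvector x of the transpose gives \<open>\<mu> (x \<bullet> v) = p (x \<bullet> v)\<close>,
  hence \<open>x \<bullet> v = 0\<close>: the origin is a positive combination of the points. If no point had a
  positive component in the direction \<phi>, all these components would therefore vanish; then
  v would be a complex multiple of a real vector, which is impossible for a nonreal eigenvalue of a
  real matrix.

  For the second property, let the i-th point be extreme and \<open>f = exp (- \<i> \<phi>) v\<close>. Then
  \<open>Re f\<^sub>j\<close> is at most \<open>(Re f\<^sub>i / u\<^sub>i) u\<^sub>j\<close> for every j, and applying row i of A yields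
  \<open>Re (\<mu> f\<^sub>i) \<le> p Re f\<^sub>i\<close>, which is the claim.\<close>

lemma real_mat_nonreal_eigenvalue_turns:
  fixes A :: "real mat" and u :: "real vec" and v :: "complex vec"
  assumes A: "A \<in> carrier_mat n n"
    and nonneg: "\<And>i j. i < n \<Longrightarrow> j < n \<Longrightarrow> 0 \<le> A $$ (i, j)"
    and u: "u \<in> carrier_vec n" "\<And>i. i < n \<Longrightarrow> 0 < u $ i" "A *\<^sub>v u = p \<cdot>\<^sub>v u"
    and x: "x \<in> carrier_vec n" "\<And>i. i < n \<Longrightarrow> 0 < x $ i" "transpose_mat A *\<^sub>v x = p \<cdot>\<^sub>v x"
    and v: "eigenvector (map_mat complex_of_real A) v \<mu>"
    and \<mu>: "0 < Im \<mu>"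
  defines "Z \<equiv> (\<lambda>j. v $ j / u $ j) ` {..<n}"
  shows "\<exists>z\<in>Z. 0 < Re (cis (- \<phi>) * z)"
    and "\<lbrakk>z \<in> Z; \<And>w. w \<in> Z \<Longrightarrow> Re (cis (- \<phi>) * w) \<le> Re (cis (- \<phi>) * z)\<rbrakk>
      \<Longrightarrow> - Im (cis (- \<phi>) * z) \<le> (p - Re \<mu>) / Im \<mu> * Re (cis (- \<phi>) * z)"
proof -
  define f where "f = (\<lambda>i. cis (- \<phi>) * v $ i)"
  have v': "v \<in> carrier_vec n" "v \<noteq> 0\<^sub>v n"
    using v A by (auto simp: eigenvector_def)
  have f_eq: "(\<Sum>j<n. of_real (A $$ (i, j)) * f j) = \<mu> * f i" if i: "i < n" for i
  proof -
    have "(map_mat complex_of_real A *\<^sub>v v) $ i = (\<mu> \<cdot>\<^sub>v v) $ i"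
      using v by (simp add: eigenvector_def)
    then have "(\<Sum>j<n. of_real (A $$ (i, j)) * v $ j) = \<mu> * v $ i"
      using i A v'(1) by (simp add: scalar_prod_def lessThan_atLeast0)
    then have "cis (- \<phi>) * (\<Sum>j<n. of_real (A $$ (i, j)) * v $ j) = cis (- \<phi>) * (\<mu> * v $ i)"
      by simp
    then show ?thesis
      by (simp add: f_def sum_distrib_left mult_ac)
  qed
  have Re_f_eq: "(\<Sum>j<n. A $$ (i, j) * Re (f j)) = Re (\<mu> * f i)" if "i < n" for i
    using arg_cong[OF f_eq[OF that], of Re] by simp
  have u_eq: "(\<Sum>j<n. A $$ (i, j) * u $ j) = p * u $ i" if i: "i < n" for i
    using arg_cong[OF u(3), of "\<lambda>w. w $ i"] i A u(1) by (simp add: scalar_prod_def lessThan_atLeast0)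
  have x_eq: "(\<Sum>i<n. A $$ (i, j) * x $ i) = p * x $ j" if j: "j < n" for j
    using arg_cong[OF x(3), of "\<lambda>w. w $ j"] j A x(1) by (simp add: scalar_prod_def lessThan_atLeast0)
  have Re_rot: "Re (cis (- \<phi>) * (v $ j / u $ j)) = Re (f j) / u $ j"
    and Im_rot: "Im (cis (- \<phi>) * (v $ j / u $ j)) = Im (f j) / u $ j" for j
  proof -
    have eq: "cis (- \<phi>) * (v $ j / u $ j) = f j / of_real (u $ j)"
      by (simp add: f_def)
    then show "Re (cis (- \<phi>) * (v $ j / u $ j)) = Re (f j) / u $ j"
      "Im (cis (- \<phi>) * (v $ j / u $ j)) = Im (f j) / u $ j"
      unfolding eq by simp_all
  qed
  show "\<exists>z\<in>Z. 0 < Re (cis (- \<phi>) * z)"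
  proof (rule ccontr)
    assume neg: "\<not> ?thesis"
    have "Re (f j) / u $ j \<le> 0" if "j < n" for j
    proof -
      have "v $ j / u $ j \<in> Z"
        using that by (simp add: Z_def)
      with neg have "\<not> 0 < Re (cis (- \<phi>) * (v $ j / u $ j))"
        by blast
      then show ?thesis
        unfolding Re_rot by simp
    qed
    then have Re_le: "Re (f j) \<le> 0" if "j < n" for j
      using that u(2) by (fastforce simp: divide_le_0_iff)
    have "\<mu> * (\<Sum>i<n. x $ i * f i) = (\<Sum>i<n. x $ i * (\<Sum>j<n. of_real (A $$ (i, j)) * f j))"
      by (simp add: f_eq sum_distrib_left[of \<mu>] mult.left_commute)
    also have "\<dots> = (\<Sum>j<n. of_real (\<Sum>i<n. A $$ (i, j) * x $ i) * f j)"
      unfolding sum_distrib_left of_real_sum sum_distrib_right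
      by (subst sum.swap) (simp add: mult_ac)
    also have "\<dots> = p * (\<Sum>i<n. x $ i * f i)"
      by (simp add: x_eq sum_distrib_left[of "of_real p"] mult.assoc)
    finally have "(\<mu> - p) * (\<Sum>i<n. x $ i * f i) = 0"
      by (simp add: algebra_simps)
    moreover have "\<mu> \<noteq> p"
      using \<mu> by auto
    ultimately have "(\<Sum>i<n. x $ i * f i) = 0"
      by simp
    then have "Re (\<Sum>i<n. x $ i * f i) = 0"
      by simp
    then have "(\<Sum>i<n. x $ i * Re (f i)) = 0"
      by simp
    then have "(\<Sum>i<n. x $ i * - Re (f i)) = 0"
      by (simp add: sum_negf)
    then have "x $ i * - Re (f i) = 0" if "i < n" for i
      using that Re_le x(2)
      by (subst (asm) sum_nonneg_eq_0_iff) (auto simp: mult_le_0_iff less_imp_le)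
    then have Re_0: "Re (f i) = 0" if "i < n" for i
      using that x(2) by fastforce
    \<comment> \<open>The real part of the i-th eigenvalue equation now reads \<open>0 = - Im \<mu> * Im (f i)\<close>.\<close>
    have "f i = 0" if i: "i < n" for i
      using Re_f_eq[OF i] Re_0 i \<mu> by (simp add: complex_eq_iff)
    then have "v = 0\<^sub>v n"
      using v'(1) by (intro eq_vecI) (auto simp: f_def)
    with v'(2) show False
      by simp
  qed
  assume "z \<in> Z" and max: "\<And>w. w \<in> Z \<Longrightarrow> Re (cis (- \<phi>) * w) \<le> Re (cis (- \<phi>) * z)"
  then obtain i where i: "i < n" "z = v $ i / u $ i"
    by (auto simp: Z_def)
  have "Re (f j) \<le> Re (f i) / u $ i * u $ j" if j: "j < n" for j
  proof -
    have "Re (f j) / u $ j \<le> Re (f i) / u $ i"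
      using max[of "v $ j / u $ j"] j unfolding Z_def i(2) Re_rot by blast
    then show ?thesis
      using u(2)[OF j] by (simp add: pos_divide_le_eq)
  qed
  then have "Re (\<mu> * f i) \<le> (\<Sum>j<n. A $$ (i, j) * (Re (f i) / u $ i * u $ j))"
    unfolding Re_f_eq[OF i(1), symmetric] using nonneg i(1) by (intro sum_mono mult_left_mono) auto
  also have "\<dots> = Re (f i) / u $ i * (\<Sum>j<n. A $$ (i, j) * u $ j)"
    by (simp add: sum_distrib_left mult_ac)
  also have "\<dots> = p * Re (f i)"
    using u(2)[OF i(1)] by (simp add: u_eq[OF i(1)])
  finally have "- Im (f i) \<le> (p - Re \<mu>) / Im \<mu> * Re (f i)"
    using \<mu> by (simp add: field_simps)
  then have "- Im (f i) / u $ i \<le> (p - Re \<mu>) / Im \<mu> * Re (f i) / u $ i"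
    using u(2)[OF i(1)] by (intro divide_right_mono) auto
  then show "- Im (cis (- \<phi>) * z) \<le> (p - Re \<mu>) / Im \<mu> * Re (cis (- \<phi>) * z)"
    unfolding i(2) Re_rot Im_rot by simp
qed

text \<open>The absolute value of \<open>Im p'\<close> is harmless: the characteristic polynomial is real, so \<mu> can
  be taken to be whichever of p' and its complex conjugate lies in the upper half plane.\<close>

lemma pf_dims_ge_pi_over_angle:
  fixes p :: real and p' :: complex
  assumes n: "n \<in> pf_dims p" and "0 < p"
    and conj: "galois_conjugate (complex_of_real p) p'"
    and "Im p' \<noteq> 0" and gap: "Re p' < p"
  shows "pi \<le> real n * arctan ((p - Re p') / \<bar>Im p'\<bar>)"
proof -
  obtain A where "0 < n" and A: "A \<in> carrier_mat n n" and "aperiodic_mat A"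
    and p: "spectral_radius (map_mat complex_of_int A) = p"
    using n by (auto simp: pf_dims_def)
  then obtain k where nonneg: "\<And>i j. i < n \<Longrightarrow> j < n \<Longrightarrow> 0 \<le> A $$ (i, j)"
    and prim: "\<And>i j. i < n \<Longrightarrow> j < n \<Longrightarrow> 0 < (A ^\<^sub>m k) $$ (i, j)"
    unfolding aperiodic_mat_def nonneg_int_mat_def by (metis carrier_matD)
  define R where "R = map_mat real_of_int A"
  define C where "C = map_mat complex_of_int A"
  have R: "R \<in> carrier_mat n n" and C: "C \<in> carrier_mat n n"
    using A by (auto simp: R_def C_def)
  have C_R: "C = map_mat complex_of_real R"
    by (auto simp: C_def R_def)
  have R_nonneg: "0 \<le> R $$ (i, j)" if "i < n" "j < n" for i j
    using that nonneg A by (simp add: R_def)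
  have Rk: "R ^\<^sub>m k = map_mat real_of_int (A ^\<^sub>m k)"
    unfolding R_def by (rule of_int_hom.mat_hom_pow[OF A, symmetric])
  have R_prim: "0 < (R ^\<^sub>m k) $$ (i, j)" if "i < n" "j < n" for i j
    using that prim A by (simp add: Rk)
  have p_R: "spectral_radius (map_mat complex_of_real R) = p"
    using p by (simp add: C_R[symmetric] C_def)
  obtain u where u: "u \<in> carrier_vec n" "\<And>i. i < n \<Longrightarrow> 0 < u $ i" "R *\<^sub>v u = p \<cdot>\<^sub>v u"
    using primitive_positive_eigenvector[OF R \<open>0 < n\<close> R_nonneg R_prim p_R \<open>0 < p\<close>] by blast
  obtain x where x: "x \<in> carrier_vec n" "\<And>i. i < n \<Longrightarrow> 0 < x $ i" "R\<^sup>T *\<^sub>v x = p \<cdot>\<^sub>v x"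
  proof (rule primitive_positive_eigenvector)
    show "R\<^sup>T \<in> carrier_mat n n"
      using R by simp
    show "0 \<le> R\<^sup>T $$ (i, j)" if "i < n" "j < n" for i j
      using that R R_nonneg by simp
    show "0 < (R\<^sup>T ^\<^sub>m k) $$ (i, j)" if "i < n" "j < n" for i j
      using that R R_prim by (simp add: transpose_pow_mat[OF R])
    have "map_mat complex_of_real R\<^sup>T = C\<^sup>T"
      by (auto simp: C_R)
    then show "spectral_radius (map_mat complex_of_real R\<^sup>T) = p"
      using spectral_radius_transpose[OF C] p by (simp add: C_def)
  qed (use \<open>0 < n\<close> \<open>0 < p\<close> in auto)
  have char_poly_C: "char_poly C = map_poly of_int (char_poly A)"
    unfolding C_def by (rule of_int_hom.char_poly_hom[OF A])
  have "u \<noteq> 0\<^sub>v n"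
    using u(2)[OF \<open>0 < n\<close>] \<open>0 < n\<close> by auto
  then have "eigenvector R u p"
    using u R by (simp add: eigenvector_def)
  then have "eigenvalue C p"
    unfolding C_R eigenvalue_def using of_real_hom.eigenvector_hom[OF R] by blast
  then have "poly (map_poly of_int (char_poly A)) (complex_of_real p) = 0"
    using eigenvalue_root_char_poly[OF C] by (simp add: char_poly_C)
  then have root: "poly (map_poly of_int (char_poly A)) p' = 0"
    by (rule galois_conjugate_root[OF conj])
  define \<mu> where "\<mu> = (if 0 < Im p' then p' else cnj p')"
  have \<mu>: "0 < Im \<mu>" "Im \<mu> = \<bar>Im p'\<bar>" "Re \<mu> = Re p'"
    using \<open>Im p' \<noteq> 0\<close> by (auto simp: \<mu>_def)
  have "poly (map_poly of_int (char_poly A)) (cnj p') = 0"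
    using root by (subst poly_cnj_real[symmetric]) auto
  then have "eigenvalue C \<mu>"
    using root eigenvalue_root_char_poly[OF C] by (simp add: char_poly_C \<mu>_def)
  then obtain v where v: "eigenvector (map_mat complex_of_real R) v \<mu>"
    by (auto simp: eigenvalue_def C_R)
  define \<eta> where "\<eta> = arctan ((p - Re p') / \<bar>Im p'\<bar>)"
  have \<eta>: "0 < \<eta>" "\<eta> < pi / 2"
    using gap \<open>Im p' \<noteq> 0\<close> unfolding \<eta>_def by (simp_all only: arctan_ubound) simp
  have tan: "tan \<eta> = (p - Re \<mu>) / Im \<mu>"
    by (simp add: \<eta>_def tan_arctan \<mu>)
  define Z where "Z = (\<lambda>j. v $ j / u $ j) ` {..<n}"
  note turns = real_mat_nonreal_eigenvalue_turns[OF R R_nonneg u x v \<mu>(1), folded Z_def]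
  have "pi \<le> real (card Z) * \<eta>"
  proof (rule card_rotating_maximizers_ge[OF _ \<eta>])
    show "finite Z"
      by (simp add: Z_def)
    show "\<exists>z\<in>Z. 0 < Re (cis (- \<phi>) * z)" for \<phi>
      by (rule turns(1))
    show "- Im (cis (- \<phi>) * z) \<le> tan \<eta> * Re (cis (- \<phi>) * z)"
      if "z \<in> Z" "\<And>w. w \<in> Z \<Longrightarrow> Re (cis (- \<phi>) * w) \<le> Re (cis (- \<phi>) * z)" for \<phi> z
      unfolding tan by (intro turns(2) that)
  qed
  also have "card Z \<le> n"
    unfolding Z_def by (metis card_image_le card_lessThan finite_lessThan)
  then have "real (card Z) * \<eta> \<le> real n * \<eta>"
    using \<eta> by (intro mult_right_mono) auto
  finally show ?thesis
    by (simp add: \<eta>_def)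
qed

theorem theorem1p1:
  fixes p \<eta> :: real and p' :: complex
  assumes "p > 0"
    and "perron_number p"
    and "galois_conjugate (complex_of_real p) p'"
    and "p' \<notin> \<real>"
    and "\<eta> = arctan ((p - Re p') / \<bar>Im p'\<bar>)"
    and "\<eta> \<le> 1"
  shows "ereal_of_enat (pf_degree p) \<ge> ereal (2 * pi / (3 * \<eta>))"
proof (cases "pf_dims p = {}")
  case True
  then show ?thesis
    by (simp add: pf_degree_def top_enat_def)
next
  case False
  define n where "n = (LEAST n. n \<in> pf_dims p)"
  have n: "n \<in> pf_dims p"
    unfolding n_def using False by (auto intro: LeastI)
  have "Im p' \<noteq> 0"
    using \<open>p' \<notin> \<real>\<close> by (simp add: complex_is_Real_iff)
  have "p' \<noteq> complex_of_real p"
    using \<open>p' \<notin> \<real>\<close> by auto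
  then have "cmod p' < p"
    using assms(2,3) by (auto simp: perron_number_def)
  then have "Re p' < p"
    using complex_Re_le_cmod[of p'] by linarith
  then have "0 < \<eta>"
    using \<open>Im p' \<noteq> 0\<close> by (simp add: assms(5))
  have "pi \<le> real n * \<eta>"
    unfolding assms(5) using n assms(1,3) \<open>Im p' \<noteq> 0\<close> \<open>Re p' < p\<close>
    by (rule pf_dims_ge_pi_over_angle)
  then have "pi / \<eta> \<le> real n"
    using \<open>0 < \<eta>\<close> by (simp add: field_simps)
  moreover have "2 * pi / (3 * \<eta>) \<le> pi / \<eta>"
    using \<open>0 < \<eta>\<close> by (simp add: field_simps)
  ultimately have "2 * pi / (3 * \<eta>) \<le> real n"
    by linarith
  then show ?thesis
    using pf_degree_eq_Least[OF False] by (simp add: n_def)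
qed

end
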